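(* Let $h,s\in\mathbb{R}$ with $s\neq0$, and let $\tau(h)=h^2+3h+9$. Then: 1. $\zeta(h,s)=-s\,\zeta(h,-1)$. 2. The zeros of the Ramanujan cubic polynomial $\rho(h,s,x)$ are $$-\frac{s}{3}\left(h\pm2\sqrt{\tau(h)}\,\cos\left(\frac{1}{3}\left(\arctan\left(\frac{3\sqrt{3}}{3+2h}\right)+k\pi\right)\right)\right),\qquad k=0,2,4,$$ where the sign $\pm$ is the same for the three values of $k$, being $+$ if $h\geq-\frac32$ and $-$ if $h\leq-\frac32$. 3. If $\rho(h,s,x)\in\mathbb{Q}[x]$ and $\alpha$ is a zero of $\rho(h,s,x)$, then the Galois group of the extension $\mathbb{Q}(\alpha)$ over $\mathbb{Q}$ has three elements: the identity automorphism and the automorphisms $\eta_s$ and $\eta_s^2$.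
   Context: For $h,s\in\mathbb{R}$, $s\neq 0$, the polynomial $\rho(h,s,x)=x^3+hsx^2-(h+3)s^2x+s^3$ is called a Ramanujan cubic polynomial, and $\zeta(h,s)$ denotes its set of zeros. (Writing the polynomial as $x^3+px^2+qx+r$, one has $s=r^{1/3}$ and $h=p/r^{1/3}$, with the real cube root.) For a number $c$ and a set $Z$ of numbers, $cZ=\{cz: z\in Z\}$. The function $\arctan$ takes values in $(-\frac{\pi}{2},\frac{\pi}{2})$; when $h=-\frac32$, the arctangent is read as $\arctan(+\infty)=\frac{\pi}{2}$ in the formula with sign $+$ and as $\arctan(-\infty)=-\frac{\pi}{2}$ in the formula with sign $-$. The map $\eta_s$ is $\eta_s(z)=\frac{s^2}{s-z}$, which satisfies $\eta_s^3(z)=z$, where $\eta_s^2=\eta_s\circ\eta_s$ and so $\eta_s^2(z)=-\frac{s(s-z)}{z}$; in item 3 the automorphisms $\eta_s$ and $\eta_s^2$ are those of $\mathbb{Q}(\alpha)$ sending $\alpha$ to $\eta_s(\alpha)$ and to $\eta_s^2(\alpha)$ respectively.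
   Formalization: Item 3 is proved for a zero α that is not rational; for rational α (e.g. h = −3/2, s = 1, with zeros 2, 1/2, −1) we have Q(α) = Q and the Galois group is trivial, so the item as stated fails exactly there. *)

theory Defs
  imports
    "HOL-Analysis.Analysis"
    "HOL-Algebra.Algebraic_Closure_Type"
    "HOL-Algebra.Generated_Fields"
    "HOL-Algebra.QuotRing"
    "HOL-Algebra.Bij"
begin

definition rho :: "real \<Rightarrow> real \<Rightarrow> real poly" where
  "rho h s = [:s ^ 3, - (h + 3) * s\<^sup>2, h * s, 1:]"

definition zeta :: "real \<Rightarrow> real \<Rightarrow> complex set" where
  "zeta h s = {z. poly (map_poly complex_of_real (rho h s)) z = 0}"

definition tau :: "real \<Rightarrow> real" where
  "tau h = h\<^sup>2 + 3 * h + 9"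

(* e is the sign 1 or -1 of the formula in which the arctangent occurs.  At h = -3/2 the
   fraction reads as infinity with sign e; in Isabelle it would be x / 0 = 0. *)
definition signed_arctan :: "real \<Rightarrow> real \<Rightarrow> real" where
  "signed_arctan e h =
     (if h = - 3 / 2 then e * (pi / 2) else arctan (3 * sqrt 3 / (3 + 2 * h)))"

definition trig_zero :: "real \<Rightarrow> real \<Rightarrow> real \<Rightarrow> nat \<Rightarrow> real" where
  "trig_zero e h s k =
     - (s / 3) * (h + e * 2 * sqrt (tau h) * cos (1 / 3 * (signed_arctan e h + real k * pi)))"

definition eta :: "real \<Rightarrow> complex \<Rightarrow> complex" where
  "eta s z = complex_of_real (s\<^sup>2) / (complex_of_real s - z)"

definition rat_adjoin :: "complex \<Rightarrow> complex ring" where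
  "rat_adjoin \<alpha> =
     ring_of_type_algebra
       \<lparr>carrier := generate_field ring_of_type_algebra (insert \<alpha> \<rat>)\<rparr>"

(* Automorphisms of L fixing K pointwise, under composition.  As in BijGroup, they are
   extensional functions, so that each automorphism is represented by exactly one function. *)
definition galois_group :: "('a, 'm) ring_scheme \<Rightarrow> 'a set \<Rightarrow> ('a \<Rightarrow> 'a) monoid" where
  "galois_group L K =
     BijGroup (carrier L)
       \<lparr>carrier := {\<sigma> \<in> ring_iso L L \<inter> Bij (carrier L). \<forall>x\<in>K. \<sigma> x = x}\<rparr>"

end

(*
  With phi = theta / 3, where theta is the arctangent and e the sign in the formula, the numbers
  cos (phi + k pi / 3), k = 0, 2, 4,
  are the zeros of 4 w^3 - 3 w = cos theta, and the substitution
  x = - (s / 3) (h + 2 e sqrt (tau h) w) turns this equation into the Ramanujan cubic equation.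
  Hence all zeros are real, and eta_s, which permutes the zeros and has no real fixed point,
  permutes them cyclically.  Rational coefficients force h and s to be rational, so eta_s maps
  rationals to rationals; a rational zero would make all three rational.  The cubic of an
  irrational zero alpha is therefore irreducible over Q and splits in Q(alpha), whose automorphisms
  correspond to the three possible images of alpha.
*)

theory Submission
  imports
    Defs
    "HOL-Computational_Algebra.Field_as_Ring"
    "HOL-Computational_Algebra.Polynomial_Factorial"
begin

subsection \<open>Zeros of a Ramanujan cubic polynomial\<close>

lemma mem_zeta_iff:
  "z \<in> zeta h s \<longleftrightarrow>
    z ^ 3 + of_real h * of_real s * z\<^sup>2 - (of_real h + 3) * (of_real s)\<^sup>2 * z + of_real s ^ 3 = 0"
  by (simp add: zeta_def rho_def map_poly_pCons algebra_simps power2_eq_square power3_eq_cube)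

text \<open>Substituting \<open>- s * z\<close> into the cubic for \<open>(h, s)\<close> gives
  \<open>- (s ^ 3)\<close> times the cubic for \<open>(h, -1)\<close> at \<open>z\<close>, and this
  factor is nonzero.\<close>

lemma zeta_scale:
  assumes "s \<noteq> 0"
  shows "zeta h s = (\<lambda>z. - complex_of_real s * z) ` zeta h (-1)"
proof -
  have iff: "- complex_of_real s * z \<in> zeta h s \<longleftrightarrow> z \<in> zeta h (-1)" for z
  proof -
    let ?s = "complex_of_real s" and ?h = "complex_of_real h"
    have "(- ?s * z) ^ 3 + ?h * ?s * (- ?s * z)\<^sup>2 - (?h + 3) * ?s\<^sup>2 * (- ?s * z) + ?s ^ 3
      = (- (?s ^ 3)) * (z ^ 3 + ?h * of_real (-1) * z\<^sup>2 - (?h + 3) * (of_real (-1))\<^sup>2 * z + of_real (-1) ^ 3)"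
      by (simp add: algebra_simps power2_eq_square power3_eq_cube)
    then show ?thesis
      using assms unfolding mem_zeta_iff by (simp only: mult_eq_0_iff) simp
  qed
  show ?thesis
  proof (intro equalityI subsetI)
    fix z assume "z \<in> zeta h s"
    moreover have "z = - complex_of_real s * (- z / complex_of_real s)"
      using assms by simp
    ultimately show "z \<in> (\<lambda>z. - complex_of_real s * z) ` zeta h (-1)"
      using iff by (metis image_eqI)
  next
    fix z assume "z \<in> (\<lambda>z. - complex_of_real s * z) ` zeta h (-1)"
    then show "z \<in> zeta h s"
      using iff by blast
  qed
qed

subsection \<open>The trigonometric formula\<close>

text \<open>These are Vieta's relations for \<open>4 * w ^ 3 - 3 * w = cos (3 * x)\<close>, which by
  the triple-angle formula has the three cosines as zeros. They are verified directly:
  \<open>c 2\<close> and \<open>c 4\<close> differ only in the sign of the sine term, so their sum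
  and product are polynomials in \<open>cos x\<close>.\<close>

lemma cos_thirds:
  fixes x :: real
  defines "c \<equiv> \<lambda>k. cos (x + real k * pi / 3)"
  shows "c 0 + c 2 + c 4 = 0"
    and "c 0 * c 2 + c 0 * c 4 + c 2 * c 4 = - 3 / 4"
    and "c 0 * c 2 * c 4 = cos (3 * x) / 4"
proof -
  have c2: "c 2 = - cos x / 2 - sqrt 3 / 2 * sin x"
    by (simp add: c_def cos_add cos_120 sin_120)
  have "cos (4 * pi / 3) = - 1 / 2" "sin (4 * pi / 3) = - sqrt 3 / 2"
    using cos_periodic_pi[of "pi / 3"] sin_periodic_pi[of "pi / 3"] by (simp_all add: cos_60 sin_60)
  then have c4: "c 4 = - cos x / 2 + sqrt 3 / 2 * sin x"
    by (simp add: c_def cos_add)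
  have c0: "c 0 = cos x"
    by (simp add: c_def)
  have s: "sin x * sin x = 1 - cos x * cos x"
    by (metis power2_eq_square sin_squared_eq)
  have prod: "c 2 * c 4 = cos x * cos x / 4 - 3 / 4 * (sin x * sin x)"
    by (simp add: c2 c4 field_simps)
  show "c 0 + c 2 + c 4 = 0"
    by (simp add: c0 c2 c4)
  have "c 0 * c 2 + c 0 * c 4 + c 2 * c 4 = c 0 * (c 2 + c 4) + c 2 * c 4"
    by (simp add: algebra_simps)
  then show "c 0 * c 2 + c 0 * c 4 + c 2 * c 4 = - 3 / 4"
    unfolding prod s by (simp add: c0 c2 c4 algebra_simps)
  have "c 0 * c 2 * c 4 = cos x * (cos x * cos x / 4 - 3 / 4 * (1 - cos x * cos x))"
    by (simp only: mult.assoc prod s c0)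
  also have "\<dots> = cos (3 * x) / 4"
    unfolding cos_treble_cos by (simp add: field_simps power3_eq_cube)
  finally show "c 0 * c 2 * c 4 = cos (3 * x) / 4" .
qed

lemma tau_pos: "tau h > 0"
proof -
  have "tau h = (h + 3 / 2)\<^sup>2 + 27 / 4"
    by (simp add: tau_def power2_eq_square algebra_simps)
  moreover have "(h + 3 / 2)\<^sup>2 \<ge> 0"
    by simp
  ultimately show ?thesis
    by linarith
qed

text \<open>The cosine of an arctangent is positive, so it yields only the absolute value of
  \<open>2 * h + 3\<close>; the factor \<open>e\<close> restores the sign.\<close>

lemma cos_signed_arctan:
  assumes "e = 1 \<and> h \<ge> - 3 / 2 \<or> e = - 1 \<and> h \<le> - 3 / 2"
  shows "e * 2 * sqrt (tau h) * cos (signed_arctan e h) = 2 * h + 3"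
proof (cases "h = - 3 / 2")
  \<comment> \<open>At this boundary value the angle is \<open>pi / 2\<close> or
    \<open>- pi / 2\<close>, so both sides vanish.\<close>
  case True
  then show ?thesis
    using assms by (auto simp: signed_arctan_def)
next
  case False
  define d where "d = 3 + 2 * h"
  have d: "d \<noteq> 0" "e * \<bar>d\<bar> = d" "e * e = 1"
    using False assms by (auto simp: d_def)
  \<comment> \<open>This rests on \<open>d * d + 27 = 4 * tau h\<close>.\<close>
  have "1 + (3 * sqrt 3 / d)\<^sup>2 = (2 * sqrt (tau h) / \<bar>d\<bar>)\<^sup>2"
    using d tau_pos[of h]
    by (simp add: power_mult_distrib power_divide field_simps) (simp add: tau_def d_def power2_eq_square algebra_simps)
  then have "sqrt (1 + (3 * sqrt 3 / d)\<^sup>2) = 2 * sqrt (tau h) / \<bar>d\<bar>"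
    using tau_pos[of h] by simp
  then have "cos (signed_arctan e h) = \<bar>d\<bar> / (2 * sqrt (tau h))"
    using False by (simp add: signed_arctan_def cos_arctan d_def)
  then show ?thesis
    using d tau_pos[of h] by (simp add: d_def)
qed

text \<open>Matching the elementary symmetric functions of the three candidates with the
  coefficients factors the cubic completely, which gives the whole zero set at once.\<close>

lemma zeta_trig:
  assumes e: "e = 1 \<and> h \<ge> - 3 / 2 \<or> e = - 1 \<and> h \<le> - 3 / 2"
  shows "zeta h s = (\<lambda>k. complex_of_real (trig_zero e h s k)) ` {0, 2, 4}"
proof -
  define \<theta> where "\<theta> = signed_arctan e h"
  define c where "c k = cos (\<theta> / 3 + real k * pi / 3)" for k
  define r where "r = e * 2 * sqrt (tau h)"
  have trig: "trig_zero e h s k = - (s / 3) * (h + r * c k)" for k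
    by (simp add: trig_zero_def r_def c_def \<theta>_def add_divide_distrib)
  note c = cos_thirds[of "\<theta> / 3", folded c_def]
  have rc: "r * cos \<theta> = 2 * h + 3"
    using cos_signed_arctan[OF e] by (simp add: r_def \<theta>_def)
  have r2: "r\<^sup>2 = 4 * tau h"
    using e tau_pos[of h] by (auto simp: r_def power_mult_distrib)
  \<comment> \<open>Each \<open>a k\<close> is a negated candidate zero, so that the symmetric
    functions equal the coefficients without alternating signs.\<close>
  define a where "a k = s / 3 * (h + r * c k)" for k
  have sum1: "a 0 + a 2 + a 4 = h * s"
  proof -
    have "a 0 + a 2 + a 4 = h * s + s / 3 * r * (c 0 + c 2 + c 4)"
      by (simp add: a_def field_simps)
    then show ?thesis
      unfolding c by simp
  qed
  have sum2: "a 0 * a 2 + a 0 * a 4 + a 2 * a 4 = - (h + 3) * s\<^sup>2"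
  proof -
    have "a 0 * a 2 + a 0 * a 4 + a 2 * a 4
      = s\<^sup>2 / 9 * (3 * h\<^sup>2 + 2 * h * r * (c 0 + c 2 + c 4) + r\<^sup>2 * (c 0 * c 2 + c 0 * c 4 + c 2 * c 4))"
      by (simp add: a_def field_simps power2_eq_square)
    also have "\<dots> = - (h + 3) * s\<^sup>2"
      unfolding c r2 by (simp add: tau_def field_simps power2_eq_square)
    finally show ?thesis .
  qed
  have sum3: "a 0 * a 2 * a 4 = s ^ 3"
  proof -
    have "a 0 * a 2 * a 4
      = s ^ 3 / 27 * (h ^ 3 + h\<^sup>2 * r * (c 0 + c 2 + c 4)
        + h * r\<^sup>2 * (c 0 * c 2 + c 0 * c 4 + c 2 * c 4) + r\<^sup>2 * (r * (c 0 * c 2 * c 4)))"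
      by (simp add: a_def field_simps power2_eq_square power3_eq_cube)
    \<comment> \<open>Splitting \<open>r ^ 3\<close> lets one factor \<open>r\<close> meet
      \<open>cos \<theta>\<close>; their product is \<open>2 * h + 3\<close>, which no longer
      depends on the sign \<open>e\<close>.\<close>
    also have "r * (c 0 * c 2 * c 4) = (2 * h + 3) / 4"
      unfolding c using rc by simp
    also have "s ^ 3 / 27 * (h ^ 3 + h\<^sup>2 * r * (c 0 + c 2 + c 4)
        + h * r\<^sup>2 * (c 0 * c 2 + c 0 * c 4 + c 2 * c 4) + r\<^sup>2 * ((2 * h + 3) / 4)) = s ^ 3"
      unfolding c r2 by (simp add: tau_def field_simps power2_eq_square power3_eq_cube)
    finally show ?thesis .
  qed
  have "z ^ 3 + of_real h * of_real s * z\<^sup>2 - (of_real h + 3) * (of_real s)\<^sup>2 * z + of_real s ^ 3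
    = (z + of_real (a 0)) * (z + of_real (a 2)) * (z + of_real (a 4))" for z :: complex
  proof -
    have "(z + of_real (a 0)) * (z + of_real (a 2)) * (z + of_real (a 4))
      = z ^ 3 + of_real (a 0 + a 2 + a 4) * z\<^sup>2
        + of_real (a 0 * a 2 + a 0 * a 4 + a 2 * a 4) * z + of_real (a 0 * a 2 * a 4)"
      by (simp add: algebra_simps power2_eq_square power3_eq_cube)
    then show ?thesis
      unfolding sum1 sum2 sum3 by (simp add: algebra_simps)
  qed
  then have "z \<in> zeta h s \<longleftrightarrow> z = - of_real (a 0) \<or> z = - of_real (a 2) \<or> z = - of_real (a 4)" for z
    by (simp add: mem_zeta_iff add_eq_0_iff2)
  moreover have "trig_zero e h s k = - a k" for k
    by (simp add: trig a_def)
  ultimately show ?thesis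
    by (auto simp: image_iff)
qed

text \<open>Reality is what excludes fixed points of \<open>eta s\<close>, since these solve
  \<open>x * x - s * x + s * s = 0\<close>, an equation of negative discriminant.\<close>

corollary zeta_real:
  assumes "z \<in> zeta h s"
  obtains x where "z = complex_of_real x"
proof (cases "h \<ge> - 3 / 2")
  case True
  then show ?thesis
    using assms zeta_trig[of 1 h s] that by auto
next
  case False
  then show ?thesis
    using assms zeta_trig[of "-1" h s] that by auto
qed

subsection \<open>The order three symmetry\<close>

text \<open>The linear factors belonging to \<open>z\<close>, \<open>eta s z\<close> and
  \<open>eta s (eta s z)\<close>, cleared of denominators, multiply to a nonzero multiple of the
  cubic.\<close>

lemma zeta_eta:
  assumes "s \<noteq> 0" "z \<in> zeta h s"
  shows "zeta h s = {z, eta s z, eta s (eta s z)}"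
    and "eta s z \<noteq> z" "eta s (eta s z) \<noteq> z" "eta s (eta s z) \<noteq> eta s z"
    and "eta s (eta s (eta s z)) = z"
proof -
  let ?s = "complex_of_real s" and ?h = "complex_of_real h"
  have s: "?s \<noteq> 0"
    using assms by simp
  have z: "z ^ 3 + ?h * ?s * z\<^sup>2 - (?h + 3) * ?s\<^sup>2 * z + ?s ^ 3 = 0"
    using assms by (simp add: mem_zeta_iff)
  have z0: "z \<noteq> 0" and zs: "?s - z \<noteq> 0"
  proof -
    show "z \<noteq> 0"
      using z s by auto
    \<comment> \<open>The cubic takes the value \<open>- (s ^ 3)\<close> at \<open>s\<close>, so
      \<open>s\<close> is not a zero and the denominator in \<open>eta s z\<close> does not
      vanish.\<close>
    have "?s ^ 3 + ?h * ?s * ?s\<^sup>2 - (?h + 3) * ?s\<^sup>2 * ?s + ?s ^ 3 = - (?s ^ 3)"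
      by (simp add: algebra_simps power2_eq_square power3_eq_cube)
    moreover have "- (?s ^ 3) \<noteq> 0"
      using s by simp
    ultimately have "z \<noteq> ?s"
      using z by metis
    then show "?s - z \<noteq> 0"
      by simp
  qed
  have eta1: "eta s z = ?s\<^sup>2 / (?s - z)"
    by (simp add: eta_def)
  have eta2: "eta s (eta s z) = - ?s * (?s - z) / z"
  proof -
    have "?s - ?s\<^sup>2 / (?s - z) = - ?s * z / (?s - z)"
      using zs by (simp add: field_simps power2_eq_square)
    then show ?thesis
      using s z0 zs by (simp add: eta_def field_simps power2_eq_square)
  qed
  show eta3: "eta s (eta s (eta s z)) = z"
  proof -
    have "?s - (- ?s * (?s - z) / z) = ?s\<^sup>2 / z"
      using z0 by (simp add: field_simps power2_eq_square)
    then show ?thesis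
      unfolding eta2 using s z0 by (simp add: eta_def)
  qed
  have "x \<in> zeta h s \<longleftrightarrow> x = z \<or> x = eta s z \<or> x = eta s (eta s z)" for x
  proof -
    define P where "P x = x ^ 3 + ?h * ?s * x\<^sup>2 - (?h + 3) * ?s\<^sup>2 * x + ?s ^ 3" for x
    \<comment> \<open>The identity holds for all \<open>x\<close> and \<open>z\<close>; the
      correction term is a multiple of \<open>P z\<close> and drops out at a zero.\<close>
    have "(x - z) * ((?s - z) * x - ?s\<^sup>2) * (z * x + ?s * (?s - z))
      = z * (?s - z) * P x + x * (x - ?s) * P z"
      by (simp add: P_def algebra_simps power2_eq_square power3_eq_cube)
    moreover have "P z = 0"
      using z by (simp only: P_def)
    ultimately have "z * (?s - z) * P x = (x - z) * ((?s - z) * x - ?s\<^sup>2) * (z * x + ?s * (?s - z))"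
      by simp
    then have "P x = 0 \<longleftrightarrow> (x - z) * ((?s - z) * x - ?s\<^sup>2) * (z * x + ?s * (?s - z)) = 0"
      using z0 zs by (metis mult_eq_0_iff)
    moreover have "x \<in> zeta h s \<longleftrightarrow> P x = 0"
      by (simp only: P_def mem_zeta_iff)
    ultimately have "x \<in> zeta h s \<longleftrightarrow> x - z = 0 \<or> (?s - z) * x - ?s\<^sup>2 = 0 \<or> z * x + ?s * (?s - z) = 0"
      by (simp only: mult_eq_0_iff disj_assoc)
    moreover have "(?s - z) * x - ?s\<^sup>2 = 0 \<longleftrightarrow> x = eta s z"
      unfolding eta1 using zs by (auto simp: field_simps)
    moreover have "z * x + ?s * (?s - z) = 0 \<longleftrightarrow> x = eta s (eta s z)"
      unfolding eta2 using z0 by (auto simp: field_simps add_eq_0_iff)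
    ultimately show ?thesis
      by simp
  qed
  then show zeta: "zeta h s = {z, eta s z, eta s (eta s z)}"
    by blast
  show ne: "eta s z \<noteq> z"
  proof
    assume "eta s z = z"
    then have "?s\<^sup>2 = z * (?s - z)"
      using zs by (simp add: eta1 field_simps)
    moreover obtain x where x: "z = complex_of_real x"
      using assms zeta_real by blast
    ultimately have "complex_of_real (s\<^sup>2) = complex_of_real (x * (s - x))"
      by simp
    then have "s\<^sup>2 = x * (s - x)"
      by (simp only: of_real_eq_iff)
    moreover have "s\<^sup>2 - x * (s - x) = (x - s / 2)\<^sup>2 + 3 / 4 * s\<^sup>2"
      by (simp add: power2_eq_square field_simps)
    moreover have "(x - s / 2)\<^sup>2 + 3 / 4 * s\<^sup>2 > 0"
      using assms by (simp add: add_nonneg_pos)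
    ultimately show False
      by simp
  qed
  \<comment> \<open>Applying \<open>eta s\<close> to a coincidence and using \<open>eta3\<close>
    leads back to a fixed point, here and in the next claim.\<close>
  show "eta s (eta s z) \<noteq> z"
    using ne eta3 by metis
  show "eta s (eta s z) \<noteq> eta s z"
    using ne eta3 by metis
qed

subsection \<open>Simple extensions of the rationals\<close>

text \<open>Coefficients stay in the type \<open>rat\<close>, so that irreducibility, divisibility
  and Bezout coefficients refer to polynomials over the rationals, while the values are
  complex.\<close>

definition qpoly :: "rat poly \<Rightarrow> complex \<Rightarrow> complex" where
  "qpoly p z = poly (map_poly of_rat p) z"

lemma qpoly_0 [simp]: "qpoly 0 z = 0"
  by (simp add: qpoly_def)

lemma qpoly_pCons [simp]: "qpoly (pCons a p) z = of_rat a + z * qpoly p z"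
  by (simp add: qpoly_def map_poly_pCons)

lemma qpoly_1 [simp]: "qpoly 1 z = 1"
  by (simp flip: pCons_one)

lemma qpoly_add [simp]: "qpoly (p + q) z = qpoly p z + qpoly q z"
  by (induction p q rule: poly_induct2) (simp_all add: of_rat_add algebra_simps)

lemma qpoly_smult [simp]: "qpoly (Polynomial.smult a p) z = of_rat a * qpoly p z"
  by (induction p) (simp_all add: of_rat_mult algebra_simps)

lemma qpoly_minus [simp]: "qpoly (- p) z = - qpoly p z"
  using qpoly_smult[of "-1" p z] by (simp add: of_rat_minus)

lemma qpoly_mult [simp]: "qpoly (p * q) z = qpoly p z * qpoly q z"
  by (induction p) (simp_all add: algebra_simps)

lemma qpoly_diff [simp]: "qpoly (p - q) z = qpoly p z - qpoly q z"
  using qpoly_add[of p "- q" z] by simp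

lemma qpoly_of_rat [simp]: "qpoly p (of_rat x) = of_rat (poly p x)"
  by (induction p) (simp_all add: of_rat_add of_rat_mult)

text \<open>An irreducible \<open>m\<close> not dividing \<open>p\<close> is coprime to
  \<open>p\<close>. Evaluating a Bezout identity at \<open>z\<close> kills the multiple of
  \<open>m\<close>.\<close>

lemma qpoly_bezout:
  assumes "Factorial_Ring.irreducible m" "qpoly m z = 0" "\<not> m dvd p"
  obtains v where "qpoly p z * qpoly v z = 1"
proof -
  have "coprime m p"
    using assms by (simp add: prime_elem_imp_coprime irreducible_imp_prime_elem_gcd)
  then obtain u v where "u * m + v * p = 1"
    by (metis bezout_coefficients_fst_snd coprime_imp_gcd_eq_1)
  then have "qpoly (u * m + v * p) z = qpoly 1 z"
    by simp
  then show ?thesis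
    using assms by (intro that[of v]) (simp add: mult.commute)
qed

text \<open>Thus \<open>m\<close> is the minimal polynomial of \<open>z\<close> up to a constant: if
  it did not divide \<open>p\<close>, the value \<open>qpoly p z\<close> would be
  invertible.\<close>

lemma qpoly_eq_0_iff_dvd:
  assumes "Factorial_Ring.irreducible m" "qpoly m z = 0"
  shows "qpoly p z = 0 \<longleftrightarrow> m dvd p"
proof
  assume "qpoly p z = 0"
  then show "m dvd p"
    using qpoly_bezout[OF assms] by (metis mult_zero_left zero_neq_one)
next
  assume "m dvd p"
  then show "qpoly p z = 0"
    using assms by (auto elim!: dvdE)
qed

lemma qpoly_inverse:
  assumes "Factorial_Ring.irreducible m" "qpoly m z = 0"
  shows "\<exists>q. inverse (qpoly p z) = qpoly q z"
proof (cases "m dvd p")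
  \<comment> \<open>The value is 0 and so is its \<open>inverse\<close> by convention, hence
    \<open>p\<close> itself serves as \<open>q\<close>.\<close>
  case True
  then show ?thesis
    using qpoly_eq_0_iff_dvd[OF assms] by (metis inverse_zero)
next
  case False
  then show ?thesis
    using qpoly_bezout[OF assms] by (metis inverse_unique)
qed

section \<open>The field generated by an algebraic number\<close>

lemma ring_of_type_algebra_a_inv: "\<ominus>\<^bsub>ring_of_type_algebra\<^esub> x = - (x :: 'a :: comm_ring_1)"
proof -
  interpret ring "ring_of_type_algebra :: 'a ring"
    by (rule ring_from_type_algebra)
  show ?thesis
    by (rule minus_equality) (simp_all add: ring_of_type_algebra_def)
qed

lemma ring_of_type_algebra_inv:
  assumes "x \<noteq> 0"
  shows "inv\<^bsub>ring_of_type_algebra\<^esub> x = inverse (x :: 'a :: field)"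
proof -
  interpret field "ring_of_type_algebra :: 'a ring"
    by (rule field_from_type_algebra)
  show ?thesis
    using assms by (intro inv_unique'[symmetric]) (simp_all add: ring_of_type_algebra_def)
qed

text \<open>Polynomial values at \<open>z\<close> are closed under inverses by
  \<open>qpoly_inverse\<close>, so they already form a field; conversely, Horner's scheme builds
  each value by field operations.\<close>

lemma generate_field_adjoin:
  assumes "Factorial_Ring.irreducible m" "qpoly m z = 0"
  shows "generate_field ring_of_type_algebra (insert z \<rat>) = range (\<lambda>p. qpoly p z)"
    (is "?K = _")
proof (intro equalityI subsetI)
  fix x assume "x \<in> ?K"
  then have "\<exists>p. x = qpoly p z"
  proof induction
    case one
    then show ?case
      by (metis qpoly_1 ring_of_type_algebra_def monoid.select_convs(2))
  next
    case (incl x)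
    have "z = qpoly [:0, 1:] z"
      by simp
    moreover have "of_rat a = qpoly [:a:] z" for a
      by simp
    ultimately show ?case
      using incl by (metis Rats_cases insertE)
  next
    case (a_inv x)
    then show ?case
      by (metis qpoly_minus ring_of_type_algebra_a_inv)
  next
    case (m_inv x)
    then have "x \<noteq> 0"
      by (simp add: ring_of_type_algebra_def)
    then show ?case
      using m_inv assms qpoly_inverse by (metis ring_of_type_algebra_inv)
  next
    case (eng_add x y)
    then show ?case
      by (auto simp: ring_of_type_algebra_def simp flip: qpoly_add)
  next
    case (eng_mult x y)
    then show ?case
      by (auto simp: ring_of_type_algebra_def simp flip: qpoly_mult)
  qed
  then show "x \<in> range (\<lambda>p. qpoly p z)"
    by blast
next
  fix x assume "x \<in> range (\<lambda>p. qpoly p z)"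
  then obtain p where "x = qpoly p z"
    by blast
  moreover have "qpoly p z \<in> ?K"
  proof (induction p)
    case 0
    have "z + (- z) \<in> ?K"
      using generate_field.eng_add[of z ring_of_type_algebra "insert z \<rat>" "- z"]
        generate_field.a_inv[of z ring_of_type_algebra "insert z \<rat>"]
      by (simp add: generate_field.incl ring_of_type_algebra_a_inv ring_of_type_algebra_def)
    then show ?case
      by simp
  next
    case (pCons a p)
    have a: "of_rat a \<in> ?K" and z: "z \<in> ?K"
      by (auto intro: generate_field.incl)
    have "of_rat a \<oplus>\<^bsub>ring_of_type_algebra\<^esub> (z \<otimes>\<^bsub>ring_of_type_algebra\<^esub> qpoly p z) \<in> ?K"
      by (intro generate_field.eng_add generate_field.eng_mult a z pCons.IH)
    then show ?case
      by (simp add: ring_of_type_algebra_def)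
  qed
  ultimately show "x \<in> ?K"
    by simp
qed

lemma Rats_subset_range_qpoly: "\<rat> \<subseteq> range (\<lambda>p. qpoly p z)"
proof
  fix x :: complex assume "x \<in> \<rat>"
  then obtain a where "x = of_rat a"
    by (rule Rats_cases)
  then have "x = qpoly [:a:] z"
    by simp
  then show "x \<in> range (\<lambda>p. qpoly p z)"
    by blast
qed

text \<open>Composing polynomials gives the inclusion. It serves to compare the fields generated by
  different zeros of one cubic.\<close>

lemma range_qpoly_mono:
  assumes "w \<in> range (\<lambda>p. qpoly p z)"
  shows "range (\<lambda>p. qpoly p w) \<subseteq> range (\<lambda>p. qpoly p z)"
proof clarify
  fix p
  obtain q where q: "w = qpoly q z"
    using assms by blast
  have "qpoly p w \<in> range (\<lambda>p. qpoly p z)"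
  proof (induction p)
    case 0
    then show ?case
      by (metis qpoly_0 rangeI)
  next
    case (pCons a p)
    then obtain r where "qpoly p w = qpoly r z"
      by blast
    then have "qpoly (pCons a p) w = qpoly ([:a:] + q * r) z"
      by (simp add: q)
    then show ?case
      by blast
  qed
  then show "qpoly p w \<in> range (\<lambda>p. qpoly p z)" .
qed

subsection \<open>Automorphisms of a simple extension\<close>

text \<open>The group is unfolded into complex arithmetic. Preservation of 1 is contained in fixing
  the rationals.\<close>

lemma mem_galois_group_iff:
  assumes "Factorial_Ring.irreducible m" "qpoly m z = 0"
  defines "K \<equiv> range (\<lambda>p. qpoly p z)"
  shows "\<sigma> \<in> carrier (galois_group (rat_adjoin z) \<rat>) \<longleftrightarrow>
    \<sigma> \<in> extensional K \<and> bij_betw \<sigma> K K \<and> (\<forall>x\<in>\<rat>. \<sigma> x = x) \<and>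
    (\<forall>x\<in>K. \<forall>y\<in>K. \<sigma> (x + y) = \<sigma> x + \<sigma> y \<and> \<sigma> (x * y) = \<sigma> x * \<sigma> y)"
proof -
  have "carrier (rat_adjoin z) = K"
    using generate_field_adjoin[OF assms(1,2)] by (simp add: rat_adjoin_def K_def)
  moreover have "x \<oplus>\<^bsub>rat_adjoin z\<^esub> y = x + y" "x \<otimes>\<^bsub>rat_adjoin z\<^esub> y = x * y"
    "\<one>\<^bsub>rat_adjoin z\<^esub> = 1" for x y
    by (simp_all add: rat_adjoin_def ring_of_type_algebra_def)
  ultimately show ?thesis
    by (auto simp: galois_group_def ring_iso_def ring_hom_def Bij_def dest: bij_betwE)
qed

text \<open>An automorphism fixes the rational coefficients, so it commutes with evaluation and is
  determined by its value at \<open>z\<close>.\<close>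

lemma galois_qpoly:
  assumes "Factorial_Ring.irreducible m" "qpoly m z = 0"
    and "\<sigma> \<in> carrier (galois_group (rat_adjoin z) \<rat>)"
  shows "\<sigma> (qpoly p z) = qpoly p (\<sigma> z)"
proof -
  define K where "K = range (\<lambda>p. qpoly p z)"
  note \<sigma> = assms(3)[unfolded mem_galois_group_iff[OF assms(1,2)] K_def[symmetric]]
  have rat: "\<sigma> (of_rat a) = of_rat a" "of_rat a \<in> K" for a
    using \<sigma> Rats_subset_range_qpoly[of z] by (auto simp: K_def)
  have "z = qpoly [:0, 1:] z"
    by simp
  then have z: "z \<in> K"
    unfolding K_def by blast
  show ?thesis
  proof (induction p)
    case 0
    then show ?case
      using rat(1)[of 0] by simp
  next
    case (pCons a p)
    have "z * qpoly p z = qpoly (pCons 0 p) z"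
      by simp
    then have "z * qpoly p z \<in> K" "qpoly p z \<in> K"
      unfolding K_def by blast+
    then show ?case
      using \<sigma> z rat pCons.IH by simp
  qed
qed

text \<open>Injectivity is \<open>galois_qpoly\<close>. For surjectivity, a root \<open>w\<close>
  generating the same field gives the map from \<open>qpoly p z\<close> to \<open>qpoly p w\<close>;
  equality of the two ranges makes it onto.\<close>

lemma bij_betw_galois_group_roots:
  assumes "Factorial_Ring.irreducible m" "qpoly m z = 0"
  shows "bij_betw (\<lambda>\<sigma>. \<sigma> z) (carrier (galois_group (rat_adjoin z) \<rat>))
    {w. qpoly m w = 0 \<and> range (\<lambda>p. qpoly p w) = range (\<lambda>p. qpoly p z)}"
    (is "bij_betw _ ?G ?R")
proof (intro bij_betwI' ballI)
  define K where "K = range (\<lambda>p. qpoly p z)"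
  note mem_iff = mem_galois_group_iff[OF assms(1,2), folded K_def]
  {
    fix \<sigma> \<tau> assume st: "\<sigma> \<in> ?G" "\<tau> \<in> ?G"
    show "\<sigma> z = \<tau> z \<longleftrightarrow> \<sigma> = \<tau>"
    proof
      assume "\<sigma> z = \<tau> z"
      then have "\<sigma> x = \<tau> x" if "x \<in> K" for x
        using that st galois_qpoly[OF assms] unfolding K_def by (metis rangeE)
      moreover have "\<sigma> \<in> extensional K" "\<tau> \<in> extensional K"
        using st mem_iff by blast+
      ultimately show "\<sigma> = \<tau>"
        by (metis extensionalityI)
    qed simp
  next
    fix \<sigma> assume \<sigma>: "\<sigma> \<in> ?G"
    have "\<sigma> ` K = K"
      using \<sigma> mem_iff by (simp add: bij_betw_def)
    moreover have "\<sigma> ` K = range (\<lambda>p. qpoly p (\<sigma> z))"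
      using galois_qpoly[OF assms \<sigma>] by (simp add: K_def image_image)
    moreover have "qpoly m (\<sigma> z) = 0"
      using galois_qpoly[OF assms \<sigma>, of m] galois_qpoly[OF assms \<sigma>, of 0] assms(2) by simp
    ultimately show "\<sigma> z \<in> ?R"
      by (simp add: K_def)
  next
    fix w assume "w \<in> ?R"
    then have w: "qpoly m w = 0" and Kw: "range (\<lambda>p. qpoly p w) = K"
      by (simp_all add: K_def)
    \<comment> \<open>Both numbers are zeros of the same irreducible \<open>m\<close> and so satisfy
      the same polynomial relations over the rationals.\<close>
    have eq_iff: "qpoly p w = qpoly q w \<longleftrightarrow> qpoly p z = qpoly q z" for p q
      using qpoly_eq_0_iff_dvd[OF assms(1) w, of "p - q"] qpoly_eq_0_iff_dvd[OF assms, of "p - q"]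
      by simp
    \<comment> \<open>\<open>SOME\<close> picks one polynomial representing \<open>x\<close>; by
      \<open>eq_iff\<close> the result is independent of the choice.\<close>
    define \<sigma> where "\<sigma> = restrict (\<lambda>x. qpoly (SOME p. qpoly p z = x) w) K"
    have \<sigma>: "\<sigma> (qpoly p z) = qpoly p w" for p
    proof -
      have "qpoly (SOME q. qpoly q z = qpoly p z) z = qpoly p z"
        by (rule someI) simp
      then show ?thesis
        by (simp add: \<sigma>_def K_def eq_iff)
    qed
    have "\<sigma> \<in> ?G"
      unfolding mem_iff
    proof (intro conjI ballI)
      show "\<sigma> \<in> extensional K"
        by (simp add: \<sigma>_def)
      have "inj_on \<sigma> K"
        by (auto simp: inj_on_def K_def \<sigma> eq_iff)
      moreover have "\<sigma> ` K = K"
        using Kw by (simp add: K_def image_image \<sigma>)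
      ultimately show "bij_betw \<sigma> K K"
        by (simp add: bij_betw_def)
      show "\<sigma> x = x" if x: "x \<in> \<rat>" for x
      proof -
        obtain a where "x = of_rat a"
          using x by (rule Rats_cases)
        then show ?thesis
          using \<sigma>[of "[:a:]"] by simp
      qed
      fix x y assume "x \<in> K" "y \<in> K"
      then obtain p q where "x = qpoly p z" "y = qpoly q z"
        by (auto simp: K_def)
      then show "\<sigma> (x + y) = \<sigma> x + \<sigma> y" "\<sigma> (x * y) = \<sigma> x * \<sigma> y"
        using \<sigma>[of "p + q"] \<sigma>[of "p * q"] \<sigma> by simp_all
    qed
    moreover have "\<sigma> z = w"
      using \<sigma>[of "[:0, 1:]"] by simp
    ultimately show "\<exists>\<sigma>\<in>?G. w = \<sigma> z"
      by blast
  }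
qed

text \<open>If a cubic splits into two non-constant factors, one of them is linear and has a zero in
  the field.\<close>

lemma irreducible_degree_3:
  fixes m :: "'a :: field poly"
  assumes "Polynomial.degree m = 3" "\<And>x. poly m x \<noteq> 0"
  shows "Factorial_Ring.irreducible m"
proof (rule Factorial_Ring.irreducibleI)
  show "m \<noteq> 0"
    using assms by auto
  then show "\<not> m dvd 1"
    using assms by (simp add: is_unit_iff_degree)
  fix a b assume m: "m = a * b"
  then have nz: "a \<noteq> 0" "b \<noteq> 0"
    using \<open>m \<noteq> 0\<close> by auto
  have no1: "Polynomial.degree p \<noteq> 1" if "p dvd m" for p
  proof
    assume "Polynomial.degree p = 1"
    then obtain c d where p: "p = [:d, c:]" "c \<noteq> 0"
      by (metis One_nat_def degree_0 degree_pCons_eq_if degree_eq_zeroE nat.inject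
          pCons_cases pCons_eq_0_iff zero_neq_one)
    then have "poly p (- d / c) = 0"
      by simp
    then show False
      using that assms(2) by (metis dvd_trans poly_eq_0_iff_dvd)
  qed
  have "Polynomial.degree a + Polynomial.degree b = 3"
    using assms nz by (simp add: m degree_mult_eq)
  moreover have "Polynomial.degree a \<noteq> 1" "Polynomial.degree b \<noteq> 1"
    using no1 by (simp_all add: m)
  ultimately have "Polynomial.degree a = 0 \<or> Polynomial.degree b = 0"
    by arith
  then show "a dvd 1 \<or> b dvd 1"
    using nz by (auto simp: is_unit_iff_degree)
qed

subsection \<open>The Galois group of a Ramanujan cubic\<close>

lemma rho_coeffs_Rats:
  assumes "s \<noteq> 0" "\<And>i. poly.coeff (rho h s) i \<in> \<rat>"
  shows "h \<in> \<rat>" "s \<in> \<rat>"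
proof -
  have r: "s ^ 3 \<in> \<rat>" and q: "- (h + 3) * s\<^sup>2 \<in> \<rat>" and p: "h * s \<in> \<rat>"
    using assms(2)[of 0] assms(2)[of 1] assms(2)[of 2] by (simp_all add: rho_def numeral_2_eq_2)
  \<comment> \<open>In terms of the coefficients p, q, r of the cubic, s = (9 r - p q) / (p^2 - 3 q).\<close>
  have num: "9 * s ^ 3 - (h * s) * (- (h + 3) * s\<^sup>2) = s * (s\<^sup>2 * tau h)"
    and den: "(h * s)\<^sup>2 - 3 * (- (h + 3) * s\<^sup>2) = s\<^sup>2 * tau h"
    by (simp_all add: tau_def algebra_simps power2_eq_square power3_eq_cube)
  have "s\<^sup>2 * tau h \<noteq> 0"
    using assms(1) tau_pos[of h] by simp
  then have "s = (9 * s ^ 3 - (h * s) * (- (h + 3) * s\<^sup>2)) / ((h * s)\<^sup>2 - 3 * (- (h + 3) * s\<^sup>2))"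
    unfolding num den by simp
  moreover have "\<dots> \<in> \<rat>"
    by (intro Rats_divide Rats_diff Rats_mult Rats_power r q p Rats_number_of)
  ultimately show s: "s \<in> \<rat>"
    by metis
  have "h = h * s / s"
    using assms(1) by simp
  then show "h \<in> \<rat>"
    using p s by (metis Rats_divide)
qed

lemma complex_of_real_of_rat: "complex_of_real (of_rat a) = of_rat a"
  by (cases a) (simp add: of_rat_rat)

lemma eta_Rats:
  assumes "s \<in> \<rat>" "z \<in> \<rat>"
  shows "eta s z \<in> \<rat>"
proof -
  have "complex_of_real s \<in> \<rat>"
    using assms(1) by (metis Rats_cases Rats_of_rat complex_of_real_of_rat)
  then show ?thesis
    using assms(2) by (simp add: eta_def Rats_divide Rats_diff Rats_power)
qed

lemma rho_galois:
  assumes "s \<noteq> 0" "\<And>i. poly.coeff (rho h s) i \<in> \<rat>" "\<alpha> \<in> zeta h s" "\<alpha> \<notin> \<rat>"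
  shows "bij_betw (\<lambda>\<sigma>. \<sigma> \<alpha>) (carrier (galois_group (rat_adjoin \<alpha>) \<rat>))
      {\<alpha>, eta s \<alpha>, eta s (eta s \<alpha>)}"
    and "\<one>\<^bsub>galois_group (rat_adjoin \<alpha>) \<rat>\<^esub> \<in> carrier (galois_group (rat_adjoin \<alpha>) \<rat>)"
    and "\<one>\<^bsub>galois_group (rat_adjoin \<alpha>) \<rat>\<^esub> \<alpha> = \<alpha>"
proof -
  have "h \<in> \<rat>" "s \<in> \<rat>"
    using rho_coeffs_Rats assms(1,2) by blast+
  then obtain a b where h: "h = of_rat a" and s: "s = of_rat b"
    by (metis Rats_cases)
  \<comment> \<open>This is \<open>rho h s\<close> with its coefficients read as elements of
    \<open>rat\<close>.\<close>
  define m where "m = [:b ^ 3, - (a + 3) * b\<^sup>2, a * b, 1:]"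
  define K where "K z = range (\<lambda>p. qpoly p z)" for z
  have coeffs: "complex_of_real h = of_rat a" "complex_of_real s = of_rat b"
    by (simp_all add: h s complex_of_real_of_rat)
  have root: "qpoly m z = 0 \<longleftrightarrow> z \<in> zeta h s" for z
    by (simp add: m_def mem_zeta_iff coeffs of_rat_add of_rat_diff of_rat_mult of_rat_power
        of_rat_minus algebra_simps power2_eq_square power3_eq_cube)
  have no_root: "poly m x \<noteq> 0" for x
  proof
    assume "poly m x = 0"
    then have "qpoly m (of_rat x) = 0"
      by simp
    then have "of_rat x \<in> zeta h s"
      using root by blast
    then have "\<alpha> \<in> {of_rat x, eta s (of_rat x), eta s (eta s (of_rat x))}"
      using zeta_eta(1)[OF assms(1)] assms(3) by metis
    moreover have "of_rat x \<in> \<rat>" "eta s (of_rat x) \<in> \<rat>" "eta s (eta s (of_rat x)) \<in> \<rat>"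
      using \<open>s \<in> \<rat>\<close> by (simp_all add: eta_Rats)
    ultimately show False
      using assms(4) by auto
  qed
  have "Polynomial.degree m = 3"
    by (simp add: m_def)
  then have m: "Factorial_Ring.irreducible m"
    using no_root by (rule irreducible_degree_3)
  \<comment> \<open>The denominator \<open>s - z\<close> is the value at \<open>z\<close> of the
    rational polynomial \<open>[:b, -1:]\<close>, so its inverse lies in \<open>K z\<close>.\<close>
  have "eta s z \<in> K z" if z: "z \<in> zeta h s" for z
  proof -
    obtain q where "inverse (qpoly [:b, -1:] z) = qpoly q z"
      using qpoly_inverse[OF m, of z] z root by blast
    then have "eta s z = qpoly ([:b\<^sup>2:] * q) z"
      by (simp add: eta_def coeffs of_rat_power of_rat_minus divide_inverse)
    then show ?thesis
      unfolding K_def by blast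
  qed
  then have sub: "K (eta s z) \<subseteq> K z" if "z \<in> zeta h s" for z
    using that range_qpoly_mono unfolding K_def by blast
  note eta = zeta_eta[OF assms(1,3)]
  have mem: "\<alpha> \<in> zeta h s" "eta s \<alpha> \<in> zeta h s" "eta s (eta s \<alpha>) \<in> zeta h s"
    using eta(1) by blast+
  \<comment> \<open>Each application of \<open>eta s\<close> can only shrink the field, and the
    third one returns to \<open>\<alpha>\<close>, so all inclusions are equalities.\<close>
  have K: "K (eta s \<alpha>) = K \<alpha>" "K (eta s (eta s \<alpha>)) = K \<alpha>"
    using sub[OF mem(1)] sub[OF mem(2)] sub[OF mem(3)] unfolding eta(5) by blast+
  have "{w. qpoly m w = 0 \<and> K w = K \<alpha>} = {\<alpha>, eta s \<alpha>, eta s (eta s \<alpha>)}"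
    using K unfolding root eta(1) by blast
  moreover have m\<alpha>: "qpoly m \<alpha> = 0"
    using assms(3) root by blast
  ultimately show "bij_betw (\<lambda>\<sigma>. \<sigma> \<alpha>) (carrier (galois_group (rat_adjoin \<alpha>) \<rat>))
      {\<alpha>, eta s \<alpha>, eta s (eta s \<alpha>)}"
    using bij_betw_galois_group_roots[OF m m\<alpha>] unfolding K_def by simp
  \<comment> \<open>The neutral element is the identity cut down to the field, because group
    elements are extensional functions.\<close>
  have one: "\<one>\<^bsub>galois_group (rat_adjoin \<alpha>) \<rat>\<^esub> = restrict (\<lambda>x. x) (K \<alpha>)"
    using generate_field_adjoin[OF m m\<alpha>]
    by (simp add: galois_group_def BijGroup_def rat_adjoin_def K_def)
  have "x + y \<in> K \<alpha> \<and> x * y \<in> K \<alpha>" if "x \<in> K \<alpha>" "y \<in> K \<alpha>" for x y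
    using that by (auto simp: K_def simp flip: qpoly_add qpoly_mult)
  moreover have "\<rat> \<subseteq> K \<alpha>"
    unfolding K_def by (rule Rats_subset_range_qpoly)
  moreover have "bij_betw (restrict (\<lambda>x. x) (K \<alpha>)) (K \<alpha>) (K \<alpha>)"
    by (simp add: bij_betw_def inj_on_def)
  ultimately show "\<one>\<^bsub>galois_group (rat_adjoin \<alpha>) \<rat>\<^esub> \<in> carrier (galois_group (rat_adjoin \<alpha>) \<rat>)"
    unfolding one mem_galois_group_iff[OF m m\<alpha>, folded K_def] by auto
  have "\<alpha> = qpoly [:0, 1:] \<alpha>"
    by simp
  then have "\<alpha> \<in> K \<alpha>"
    unfolding K_def by blast
  then show "\<one>\<^bsub>galois_group (rat_adjoin \<alpha>) \<rat>\<^esub> \<alpha> = \<alpha>"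
    by (simp add: one)
qed

text \<open>The Galois statement concerns irrational zeros: a rational one generates only the
  rationals, whose sole automorphism is the identity. This does occur: for
  \<open>h = - 3 / 2\<close> and \<open>s = 1\<close> the zeros are 2, -1 and 1/2. The sets
  \<open>{\<sigma>\<^sub>1}\<close> and \<open>{\<sigma>\<^sub>2}\<close> express that each
  automorphism is determined by its value at \<open>\<alpha>\<close>.\<close>

theorem corollary9:
  fixes h s :: real
  assumes "s \<noteq> 0"
  shows "zeta h s = (\<lambda>z. - complex_of_real s * z) ` zeta h (-1) \<and>
         (h \<ge> - 3 / 2 \<longrightarrow> zeta h s = (\<lambda>k. complex_of_real (trig_zero 1 h s k)) ` {0, 2, 4}) \<and>
         (h \<le> - 3 / 2 \<longrightarrow> zeta h s = (\<lambda>k. complex_of_real (trig_zero (-1) h s k)) ` {0, 2, 4}) \<and>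
         (\<forall>\<alpha>. (\<forall>i. poly.coeff (rho h s) i \<in> \<rat>) \<and> \<alpha> \<in> zeta h s \<and> \<alpha> \<notin> \<rat> \<longrightarrow>
           (let G = galois_group (rat_adjoin \<alpha>) \<rat> in
             card (carrier G) = 3 \<and>
             (\<exists>\<sigma>\<^sub>1 \<sigma>\<^sub>2. carrier G = {\<one>\<^bsub>G\<^esub>, \<sigma>\<^sub>1, \<sigma>\<^sub>2} \<and>
                {\<sigma> \<in> carrier G. \<sigma> \<alpha> = eta s \<alpha>} = {\<sigma>\<^sub>1} \<and>
                {\<sigma> \<in> carrier G. \<sigma> \<alpha> = (eta s ^^ 2) \<alpha>} = {\<sigma>\<^sub>2})))"
proof (intro conjI impI allI)
  show "zeta h s = (\<lambda>z. - complex_of_real s * z) ` zeta h (-1)"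
    using assms by (rule zeta_scale)
  show "zeta h s = (\<lambda>k. complex_of_real (trig_zero 1 h s k)) ` {0, 2, 4}" if "h \<ge> - 3 / 2"
    using that by (intro zeta_trig) simp
  show "zeta h s = (\<lambda>k. complex_of_real (trig_zero (-1) h s k)) ` {0, 2, 4}" if "h \<le> - 3 / 2"
    using that by (intro zeta_trig) simp
  fix \<alpha> assume \<alpha>: "(\<forall>i. poly.coeff (rho h s) i \<in> \<rat>) \<and> \<alpha> \<in> zeta h s \<and> \<alpha> \<notin> \<rat>"
  define G where "G = galois_group (rat_adjoin \<alpha>) \<rat>"
  \<comment> \<open>Evaluation at \<open>\<alpha>\<close> is injective on the group, so identities
    between automorphisms are checked on this single value.\<close>
  define v where "v = (\<lambda>\<sigma> :: complex \<Rightarrow> complex. \<sigma> \<alpha>)"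
  have bij: "bij_betw v (carrier G) {\<alpha>, eta s \<alpha>, eta s (eta s \<alpha>)}"
    and one: "\<one>\<^bsub>G\<^esub> \<in> carrier G" "v \<one>\<^bsub>G\<^esub> = \<alpha>"
    using rho_galois[OF assms] \<alpha> unfolding G_def v_def by blast+
  have distinct: "eta s \<alpha> \<noteq> \<alpha>" "eta s (eta s \<alpha>) \<noteq> \<alpha>" "eta s (eta s \<alpha>) \<noteq> eta s \<alpha>"
    using zeta_eta[OF assms] \<alpha> by blast+
  have inj: "inj_on v (carrier G)"
    using bij by (rule bij_betw_imp_inj_on)
  obtain \<sigma>1 \<sigma>2 where \<sigma>: "\<sigma>1 \<in> carrier G" "v \<sigma>1 = eta s \<alpha>" "\<sigma>2 \<in> carrier G" "v \<sigma>2 = eta s (eta s \<alpha>)"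
  proof -
    have "eta s \<alpha> \<in> v ` carrier G" "eta s (eta s \<alpha>) \<in> v ` carrier G"
      using bij_betw_imp_surj_on[OF bij] by simp_all
    then show ?thesis
      using that by (metis imageE)
  qed
  have eq: "\<sigma> = \<tau>" if "\<sigma> \<in> carrier G" "\<tau> \<in> carrier G" "v \<sigma> = v \<tau>" for \<sigma> \<tau>
    using inj_onD[OF inj] that by blast
  have "card (carrier G) = card {\<alpha>, eta s \<alpha>, eta s (eta s \<alpha>)}"
    using bij by (rule bij_betw_same_card)
  then have card: "card (carrier G) = 3"
    using distinct by auto
  have carrier: "carrier G = {\<one>\<^bsub>G\<^esub>, \<sigma>1, \<sigma>2}"
  proof (intro equalityI subsetI)
    fix \<sigma> assume mem: "\<sigma> \<in> carrier G"
    then have "v \<sigma> = \<alpha> \<or> v \<sigma> = eta s \<alpha> \<or> v \<sigma> = eta s (eta s \<alpha>)"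
      using bij_betw_apply[OF bij] by blast
    then have "\<sigma> = \<one>\<^bsub>G\<^esub> \<or> \<sigma> = \<sigma>1 \<or> \<sigma> = \<sigma>2"
      using eq[OF mem one(1)] eq[OF mem \<sigma>(1)] eq[OF mem \<sigma>(3)] one(2) \<sigma>(2,4) by argo
    then show "\<sigma> \<in> {\<one>\<^bsub>G\<^esub>, \<sigma>1, \<sigma>2}"
      by blast
  qed (use \<sigma> one in auto)
  have fibre: "{\<sigma> \<in> carrier G. v \<sigma> = w} = {\<tau>}" if "\<tau> \<in> carrier G" "v \<tau> = w" for w \<tau>
    using eq that by blast
  have fibres: "{\<sigma> \<in> carrier G. v \<sigma> = eta s \<alpha>} = {\<sigma>1}" "{\<sigma> \<in> carrier G. v \<sigma> = (eta s ^^ 2) \<alpha>} = {\<sigma>2}"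
    by (intro fibre; simp add: \<sigma> numeral_2_eq_2)+
  show "let G = galois_group (rat_adjoin \<alpha>) \<rat> in
      card (carrier G) = 3 \<and>
      (\<exists>\<sigma>\<^sub>1 \<sigma>\<^sub>2. carrier G = {\<one>\<^bsub>G\<^esub>, \<sigma>\<^sub>1, \<sigma>\<^sub>2} \<and>
         {\<sigma> \<in> carrier G. \<sigma> \<alpha> = eta s \<alpha>} = {\<sigma>\<^sub>1} \<and>
         {\<sigma> \<in> carrier G. \<sigma> \<alpha> = (eta s ^^ 2) \<alpha>} = {\<sigma>\<^sub>2})"
    unfolding Let_def G_def[symmetric]
    by (intro conjI exI[of _ \<sigma>1] exI[of _ \<sigma>2] card carrier fibres[unfolded v_def])
qed

end
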